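(* Let $\mathcal{N}=\mathcal{N}_e\cup\mathcal{N}_f$ be a disjoint union of a finite set $\mathcal{N}_e$ of $N_e$ electric trucks (ETs) and a finite set $\mathcal{N}_f$ of $N_f$ fuel-powered trucks (FPTs), with $N=N_e+N_f$. Let $M$ be an integer with $2\le M<N$, and let $0<\epsilon_e\le\epsilon_f$ be real numbers. Let $v$ be the platooning benefit function, and let feasible coalition structures, their total benefit $V(\mathcal{P})=\sum_{\mathcal{S}\in\mathcal{P}}v(\mathcal{S})$, and their numbers of ET and FPT leaders be as defined in the context. Suppose that there exists an integer $P\ge 1$ with $\lceil N/M\rceil\le P\le\lfloor N/2\rfloor$. Then: (a) Every feasible coalition structure that maximizes $V$ over all feasible coalition structures consists of the smallest feasible number $P^*$ of platoons (the smallest number of coalitions in any feasible coalition structure), and $$P^*=\begin{cases}\lceil N/M\rceil, & \text{if } M\ge 3,\\ N/2, & \text{if } M=2 \text{ and } N \text{ is even.}\end{cases}$$ (b) The optimal numbers of ET and FPT leaders of the $P^*$ platoons are $$L_e^*=\min\{N_e,P^*\},\qquad L_f^*=P^*-L_e^*.$$ That is, there exist feasible coalition structures with exactly $P^*$ platoons, $L_e^*$ ET leaders and $L_f^*$ FPT leaders, and every such structure maximizes $V$ over all feasible coalition structures.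
   Context: A coalition (platoon) is a nonempty subset $\mathcal{S}\subseteq\mathcal{N}$. Write $S=|\mathcal{S}|$, $S_e=|\mathcal{S}\cap\mathcal{N}_e|$ and $S_f=|\mathcal{S}\cap\mathcal{N}_f|$. One truck of each platoon is its leader and receives zero benefit. Each ET follower yields benefit $\epsilon_e$ and each FPT follower yields benefit $\epsilon_f$. The value $v(\mathcal{S})$ is the maximum total benefit over the choice of leader, and for $1\le S\le M$ it is $$v(\mathcal{S})=\begin{cases}\epsilon_e(S_e-1)+\epsilon_f S_f, & S_e\ge 1,\\ \epsilon_f(S_f-1), & S_e=0.\end{cases}$$ Accordingly, a platoon is led by an ET whenever it contains at least one ET, and by an FPT otherwise. A feasible coalition structure is a partition $\mathcal{P}=\{\mathcal{S}_1,\dots,\mathcal{S}_P\}$ of $\mathcal{N}$ with $2\le|\mathcal{S}_m|\le M$ for all $m$. Its total platooning benefit is $V(\mathcal{P})=\sum_{m=1}^P v(\mathcal{S}_m)$. Its number of ET leaders is the number of platoons in $\mathcal{P}$ containing at least one ET, and its number of FPT leaders is the number of platoons containing no ET. *)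

theory Defs
  imports Complex_Main "HOL-Library.Disjoint_Sets"
begin

text \<open>
  Trucks are elements of an arbitrary type; \<open>Ne\<close> is the set of electric trucks (ETs) and
  \<open>Nf\<close> the set of fuel-powered trucks (FPTs). Within \<open>Ne \<union> Nf\<close>, a truck outside \<open>Ne\<close> is an FPT.
\<close>

definition follower_benefit :: "'a set \<Rightarrow> real \<Rightarrow> real \<Rightarrow> 'a \<Rightarrow> real" where
  "follower_benefit Ne \<epsilon>e \<epsilon>f i = (if i \<in> Ne then \<epsilon>e else \<epsilon>f)"

definition benefit_with_leader :: "'a set \<Rightarrow> real \<Rightarrow> real \<Rightarrow> 'a set \<Rightarrow> 'a \<Rightarrow> real" where
  "benefit_with_leader Ne \<epsilon>e \<epsilon>f S l = (\<Sum>i\<in>S - {l}. follower_benefit Ne \<epsilon>e \<epsilon>f i)"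

text \<open>
  The value is only meaningful for finite nonempty \<open>S\<close>; the size bound \<open>M\<close> is imposed by
  feasibility below. Lemma \<open>platoon_value_eq\<close> gives the closed form.
\<close>

definition platoon_value :: "'a set \<Rightarrow> real \<Rightarrow> real \<Rightarrow> 'a set \<Rightarrow> real" where
  "platoon_value Ne \<epsilon>e \<epsilon>f S = Max (benefit_with_leader Ne \<epsilon>e \<epsilon>f S ` S)"

definition feasible :: "'a set \<Rightarrow> 'a set \<Rightarrow> nat \<Rightarrow> 'a set set \<Rightarrow> bool" where
  "feasible Ne Nf M \<P> \<longleftrightarrow>
     partition_on (Ne \<union> Nf) \<P> \<and> (\<forall>S\<in>\<P>. 2 \<le> card S \<and> card S \<le> M)"

definition total_benefit :: "'a set \<Rightarrow> real \<Rightarrow> real \<Rightarrow> 'a set set \<Rightarrow> real" where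
  "total_benefit Ne \<epsilon>e \<epsilon>f \<P> = (\<Sum>S\<in>\<P>. platoon_value Ne \<epsilon>e \<epsilon>f S)"

definition optimal :: "'a set \<Rightarrow> 'a set \<Rightarrow> nat \<Rightarrow> real \<Rightarrow> real \<Rightarrow> 'a set set \<Rightarrow> bool" where
  "optimal Ne Nf M \<epsilon>e \<epsilon>f \<P> \<longleftrightarrow>
     feasible Ne Nf M \<P> \<and>
     (\<forall>\<Q>. feasible Ne Nf M \<Q> \<longrightarrow> total_benefit Ne \<epsilon>e \<epsilon>f \<Q> \<le> total_benefit Ne \<epsilon>e \<epsilon>f \<P>)"

definition ET_leaders :: "'a set \<Rightarrow> 'a set set \<Rightarrow> nat" where
  "ET_leaders Ne \<P> = card {S \<in> \<P>. S \<inter> Ne \<noteq> {}}"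

definition FPT_leaders :: "'a set \<Rightarrow> 'a set set \<Rightarrow> nat" where
  "FPT_leaders Ne \<P> = card {S \<in> \<P>. S \<inter> Ne = {}}"

text \<open>Only meaningful when some feasible coalition structure exists.\<close>

definition min_platoons :: "'a set \<Rightarrow> 'a set \<Rightarrow> nat \<Rightarrow> nat" where
  "min_platoons Ne Nf M = (LEAST p. \<exists>\<P>. feasible Ne Nf M \<P> \<and> card \<P> = p)"

lemma sum_follower_benefit:
  assumes "finite S" "S \<subseteq> Ne \<union> Nf" "Ne \<inter> Nf = {}"
  shows "(\<Sum>i\<in>S. follower_benefit Ne \<epsilon>e \<epsilon>f i)
         = \<epsilon>e * real (card (S \<inter> Ne)) + \<epsilon>f * real (card (S \<inter> Nf))"
proof -
  have "S \<inter> - Ne = S \<inter> Nf" using assms by blast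
  then show ?thesis
    using assms(1) unfolding follower_benefit_def
    by (simp add: sum.If_cases mult.commute)
qed

lemma platoon_value_eq:
  assumes "finite S" "S \<noteq> {}" "S \<subseteq> Ne \<union> Nf" "Ne \<inter> Nf = {}" "\<epsilon>e \<le> \<epsilon>f"
  shows "platoon_value Ne \<epsilon>e \<epsilon>f S =
    (if 1 \<le> card (S \<inter> Ne)
     then \<epsilon>e * (real (card (S \<inter> Ne)) - 1) + \<epsilon>f * real (card (S \<inter> Nf))
     else \<epsilon>f * (real (card (S \<inter> Nf)) - 1))"
proof -
  let ?T = "\<epsilon>e * real (card (S \<inter> Ne)) + \<epsilon>f * real (card (S \<inter> Nf))"
  have b: "benefit_with_leader Ne \<epsilon>e \<epsilon>f S l = ?T - follower_benefit Ne \<epsilon>e \<epsilon>f l"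
    if "l \<in> S" for l
    unfolding benefit_with_leader_def
    using sum_follower_benefit[OF assms(1,3,4), of \<epsilon>e \<epsilon>f] that assms(1)
    by (simp add: sum_diff1)
  have img: "benefit_with_leader Ne \<epsilon>e \<epsilon>f S ` S = (\<lambda>l. ?T - follower_benefit Ne \<epsilon>e \<epsilon>f l) ` S"
    using b by (intro image_cong) auto
  show ?thesis
  proof (cases "S \<inter> Ne = {}")
    case True
    then have "(\<lambda>l. ?T - follower_benefit Ne \<epsilon>e \<epsilon>f l) ` S = (\<lambda>l. ?T - \<epsilon>f) ` S"
      by (intro image_cong) (auto simp: follower_benefit_def)
    also have "\<dots> = {?T - \<epsilon>f}"
      using assms(2) by auto
    finally have "(\<lambda>l. ?T - follower_benefit Ne \<epsilon>e \<epsilon>f l) ` S = {?T - \<epsilon>f}" .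
    then show ?thesis
      unfolding platoon_value_def img using True by (simp add: algebra_simps)
  next
    case False
    then obtain l where l: "l \<in> S" "l \<in> Ne" by blast
    have "Max ((\<lambda>l. ?T - follower_benefit Ne \<epsilon>e \<epsilon>f l) ` S) = ?T - \<epsilon>e"
    proof (rule Max_eqI)
      show "?T - \<epsilon>e \<in> (\<lambda>l. ?T - follower_benefit Ne \<epsilon>e \<epsilon>f l) ` S"
        using l by (intro image_eqI[of _ _ l]) (auto simp: follower_benefit_def)
    qed (use assms in \<open>auto simp: follower_benefit_def split: if_splits\<close>)
    moreover have "1 \<le> card (S \<inter> Ne)"
      using False assms(1) by (simp add: Suc_le_eq card_gt_0_iff)
    ultimately show ?thesis
      unfolding platoon_value_def img by (simp add: algebra_simps)
  qed
qed

end

theory Submission imports Defs begin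

text \<open>
  Writing \<open>p\<close> for the number of platoons and \<open>e\<close> for the number of ET leaders, the total benefit is
  \<open>\<epsilon>e Ne + \<epsilon>f Nf - (\<epsilon>e e + \<epsilon>f (p - e))\<close>, so one minimises the cost of the leaders. Since
  \<open>e \<le> min Ne p\<close>, that cost is at least \<open>\<epsilon>e min Ne p + \<epsilon>f (p - min Ne p)\<close>, which is strictly
  increasing in \<open>p\<close>. The bound is attained for every \<open>p\<close> with \<open>2 p \<le> N \<le> M p\<close>: enumerate the
  trucks with the ETs first and deal them out cyclically to \<open>p\<close> platoons.
\<close>

section \<open>Counting trucks, platoons and leaders in a feasible structure\<close>

lemma feasible_parts:
  assumes "feasible Ne Nf M \<P>" "finite Ne" "finite Nf"
  shows "finite \<P>" "\<And>S. S \<in> \<P> \<Longrightarrow> finite S" "\<And>S. S \<in> \<P> \<Longrightarrow> S \<noteq> {}"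
    "\<And>S. S \<in> \<P> \<Longrightarrow> S \<subseteq> Ne \<union> Nf"
proof -
  have part: "partition_on (Ne \<union> Nf) \<P>"
    using assms(1) by (simp add: feasible_def)
  have fin: "finite (Ne \<union> Nf)"
    using assms(2,3) by simp
  show "finite \<P>"
    using finite_elements[OF fin part] .
  show sub: "S \<subseteq> Ne \<union> Nf" if "S \<in> \<P>" for S
    using partition_onD1[OF part] that by blast
  show "finite S" if "S \<in> \<P>" for S
    using sub[OF that] fin by (rule finite_subset)
  show "S \<noteq> {}" if "S \<in> \<P>" for S
    using partition_onD3[OF part] that by blast
qed

text \<open>Used with \<open>B\<close> taken as the ETs, as the FPTs and as all trucks.\<close>

lemma sum_card_Int_partition:
  assumes "partition_on A \<P>" "finite A" "B \<subseteq> A"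
  shows "(\<Sum>S\<in>\<P>. card (S \<inter> B)) = card B"
proof -
  have "card (\<Union>S\<in>\<P>. S \<inter> B) = (\<Sum>S\<in>\<P>. card (S \<inter> B))"
  proof (rule card_UN_disjoint)
    show "finite \<P>"
      using finite_elements[OF assms(2,1)] .
    show "\<forall>S\<in>\<P>. finite (S \<inter> B)"
      using finite_subset[OF assms(3,2)] by simp
    show "\<forall>S\<in>\<P>. \<forall>T\<in>\<P>. S \<noteq> T \<longrightarrow> S \<inter> B \<inter> (T \<inter> B) = {}"
      using partition_onD2[OF assms(1)] by (auto simp: disjoint_def)
  qed
  moreover have "(\<Union>S\<in>\<P>. S \<inter> B) = B"
    using partition_onD1[OF assms(1)] assms(3) by blast
  ultimately show ?thesis
    by simp
qed

lemma leaders_add: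
  assumes "finite \<P>"
  shows "ET_leaders Ne \<P> + FPT_leaders Ne \<P> = card \<P>"
proof -
  have "{S \<in> \<P>. S \<inter> Ne \<noteq> {}} \<union> {S \<in> \<P>. S \<inter> Ne = {}} = \<P>"
    by blast
  moreover have "card ({S \<in> \<P>. S \<inter> Ne \<noteq> {}} \<union> {S \<in> \<P>. S \<inter> Ne = {}})
      = card {S \<in> \<P>. S \<inter> Ne \<noteq> {}} + card {S \<in> \<P>. S \<inter> Ne = {}}"
    using assms by (intro card_Un_disjoint) auto
  ultimately show ?thesis
    by (simp add: ET_leaders_def FPT_leaders_def)
qed

text \<open>Platoons are disjoint and each ET-led one contains an ET of its own, so it adds at least
  1 to the sum of \<open>card (S \<inter> Ne)\<close>.\<close>

lemma ET_leaders_le: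
  assumes "feasible Ne Nf M \<P>" "finite Ne" "finite Nf"
  shows "ET_leaders Ne \<P> \<le> card Ne"
proof -
  have part: "partition_on (Ne \<union> Nf) \<P>"
    using assms(1) by (simp add: feasible_def)
  note parts = feasible_parts[OF assms]
  have "ET_leaders Ne \<P> = (\<Sum>S\<in>{S \<in> \<P>. S \<inter> Ne \<noteq> {}}. 1)"
    by (simp add: ET_leaders_def)
  also have "\<dots> \<le> (\<Sum>S\<in>{S \<in> \<P>. S \<inter> Ne \<noteq> {}}. card (S \<inter> Ne))"
    using assms(2) by (intro sum_mono) (simp add: Suc_le_eq card_gt_0_iff)
  also have "\<dots> \<le> (\<Sum>S\<in>\<P>. card (S \<inter> Ne))"
    using parts(1) by (intro sum_mono2) auto
  also have "\<dots> = card Ne"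
    using assms(2,3) by (intro sum_card_Int_partition[OF part]) auto
  finally show ?thesis .
qed

lemma card_le_mult_feasible:
  assumes "feasible Ne Nf M \<P>" "finite Ne" "finite Nf"
  shows "card (Ne \<union> Nf) \<le> M * card \<P>"
proof -
  have part: "partition_on (Ne \<union> Nf) \<P>"
    using assms(1) by (simp add: feasible_def)
  have "card (Ne \<union> Nf) = (\<Sum>S\<in>\<P>. card S)"
    using sum_card_Int_partition[OF part _ order_refl] assms feasible_parts(4)[OF assms]
    by (simp add: Int_absorb2)
  also have "\<dots> \<le> (\<Sum>S\<in>\<P>. M)"
    using assms(1) by (intro sum_mono) (simp add: feasible_def)
  finally show ?thesis
    by (simp add: mult.commute)
qed

lemma total_benefit_eq:
  assumes "feasible Ne Nf M \<P>" "finite Ne" "finite Nf" "Ne \<inter> Nf = {}" "\<epsilon>e \<le> \<epsilon>f"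
  shows "total_benefit Ne \<epsilon>e \<epsilon>f \<P> = \<epsilon>e * real (card Ne) + \<epsilon>f * real (card Nf)
    - (\<epsilon>e * real (ET_leaders Ne \<P>) + \<epsilon>f * real (FPT_leaders Ne \<P>))"
proof -
  have part: "partition_on (Ne \<union> Nf) \<P>"
    using assms(1) by (simp add: feasible_def)
  note parts = feasible_parts[OF assms(1-3)]
  \<comment> \<open>Both cases of the closed form are the benefit of all trucks of \<open>S\<close>
    minus that of its leader; only the subtracted term depends on the case.\<close>
  have val: "platoon_value Ne \<epsilon>e \<epsilon>f S = \<epsilon>e * real (card (S \<inter> Ne)) + \<epsilon>f * real (card (S \<inter> Nf))
      - (if S \<inter> Ne = {} then \<epsilon>f else \<epsilon>e)" if "S \<in> \<P>" for S
    using platoon_value_eq[OF parts(2-4)[OF that] assms(4,5)] parts(2)[OF that]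
    by (auto simp: algebra_simps Suc_le_eq card_gt_0_iff)
  have ET: "(\<Sum>S\<in>\<P>. real (card (S \<inter> Ne))) = real (card Ne)"
    using sum_card_Int_partition[OF part, of Ne] assms(2,3) by (simp flip: of_nat_sum)
  have FPT: "(\<Sum>S\<in>\<P>. real (card (S \<inter> Nf))) = real (card Nf)"
    using sum_card_Int_partition[OF part, of Nf] assms(2,3) by (simp flip: of_nat_sum)
  have sets: "\<P> \<inter> {S. S \<inter> Ne = {}} = {S \<in> \<P>. S \<inter> Ne = {}}"
    "\<P> \<inter> - {S. S \<inter> Ne = {}} = {S \<in> \<P>. S \<inter> Ne \<noteq> {}}"
    by auto
  have lead: "(\<Sum>S\<in>\<P>. if S \<inter> Ne = {} then \<epsilon>f else \<epsilon>e)
      = \<epsilon>e * real (ET_leaders Ne \<P>) + \<epsilon>f * real (FPT_leaders Ne \<P>)"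
    unfolding sum.If_cases[OF parts(1)] sets ET_leaders_def FPT_leaders_def by simp
  show ?thesis
    unfolding total_benefit_def
    by (simp add: val sum_subtractf sum.distrib ET FPT lead flip: sum_distrib_left)
qed

section \<open>Cost of the leaders when as many platoons as possible are led by ETs\<close>

definition leader_cost :: "real \<Rightarrow> real \<Rightarrow> nat \<Rightarrow> nat \<Rightarrow> real" where
  "leader_cost \<epsilon>e \<epsilon>f k p = \<epsilon>e * real (min k p) + \<epsilon>f * real (p - min k p)"

text \<open>One more platoon costs one more leader: \<open>\<epsilon>e\<close> while
  \<open>Suc p \<le> k\<close>, and \<open>\<epsilon>f\<close> once the ETs are used up. Both
  increments are positive.\<close>

lemma leader_cost_strict_mono:
  assumes "0 < \<epsilon>e" "\<epsilon>e \<le> \<epsilon>f"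
  shows "strict_mono (leader_cost \<epsilon>e \<epsilon>f k)"
proof (rule strict_mono_Suc_iff[THEN iffD2], rule allI)
  fix p
  show "leader_cost \<epsilon>e \<epsilon>f k p < leader_cost \<epsilon>e \<epsilon>f k (Suc p)"
    using assms by (cases "Suc p \<le> k") (auto simp: leader_cost_def min_def algebra_simps of_nat_diff)
qed

lemma leader_cost_le:
  assumes "\<epsilon>e \<le> \<epsilon>f" "e \<le> min k (e + f)"
  shows "leader_cost \<epsilon>e \<epsilon>f k (e + f) \<le> \<epsilon>e * real e + \<epsilon>f * real f"
proof -
  \<comment> \<open>\<open>d\<close> counts the FPT leaders that ETs could replace, \<open>r\<close>
    those that remain. Each replacement saves \<open>\<epsilon>f - \<epsilon>e\<close>, which is
    nonnegative.\<close>
  define d r where "d = min k (e + f) - e" and "r = e + f - min k (e + f)"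
  have d: "min k (e + f) = e + d" and r: "e + f - min k (e + f) = r" and f: "f = d + r"
    using assms(2) by (auto simp: d_def r_def)
  have "\<epsilon>e * real d \<le> \<epsilon>f * real d"
    using assms(1) by (intro mult_right_mono) auto
  then show ?thesis
    unfolding leader_cost_def r unfolding d unfolding f by (simp add: distrib_left)
qed

lemma total_benefit_le:
  assumes "feasible Ne Nf M \<P>" "finite Ne" "finite Nf" "Ne \<inter> Nf = {}" "\<epsilon>e \<le> \<epsilon>f"
  shows "total_benefit Ne \<epsilon>e \<epsilon>f \<P> \<le> \<epsilon>e * real (card Ne) + \<epsilon>f * real (card Nf)
    - leader_cost \<epsilon>e \<epsilon>f (card Ne) (card \<P>)"
  using leader_cost_le[OF assms(5), of "ET_leaders Ne \<P>" "card Ne" "FPT_leaders Ne \<P>"]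
    ET_leaders_le[OF assms(1-3)] leaders_add[OF feasible_parts(1)[OF assms(1-3)], of Ne]
    total_benefit_eq[OF assms]
  by simp

section \<open>Dealing the trucks out cyclically\<close>

lemma card_residue_class_le:
  fixes n m p j :: nat
  assumes "n \<le> m * p"
  shows "card {i. i < n \<and> i mod p = j} \<le> m"
proof -
  \<comment> \<open>Within one residue class the quotient determines the index, and
    \<open>n \<le> m * p\<close> keeps the quotient below \<open>m\<close>.\<close>
  have "inj_on (\<lambda>i. i div p) {i. i < n \<and> i mod p = j}"
    by (auto intro!: inj_onI) (metis div_mult_mod_eq)
  moreover have "(\<lambda>i. i div p) ` {i. i < n \<and> i mod p = j} \<subseteq> {..<m}"
    using assms by (auto intro!: less_mult_imp_div_less)
  ultimately show ?thesis
    using card_inj_on_le[of _ _ "{..<m}"] by simp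
qed

lemma card_residue_class_ge:
  fixes n p j :: nat
  assumes "2 * p \<le> n" "j < p"
  shows "2 \<le> card {i. i < n \<and> i mod p = j}"
proof -
  have "card {j, j + p} \<le> card {i. i < n \<and> i mod p = j}"
    using assms by (intro card_mono) auto
  then show ?thesis
    using assms(2) by simp
qed

text \<open>The platoons are the residue classes modulo \<open>p\<close> of the positions in a list
  of all trucks. The bounds \<open>2 * p \<le> N\<close> and \<open>N \<le> M * p\<close> become the
  size bounds 2 and \<open>M\<close> on each class.\<close>

lemma ex_balanced_partition:
  assumes "finite Ne" "finite Nf" "Ne \<inter> Nf = {}" "N = card Ne + card Nf"
    and "1 \<le> p" "2 * p \<le> N" "N \<le> M * p"
  obtains \<P> where "feasible Ne Nf M \<P>" "card \<P> = p" "ET_leaders Ne \<P> = min (card Ne) p"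
proof -
  obtain xs ys where xs: "distinct xs" "set xs = Ne" and ys: "distinct ys" "set ys = Nf"
    using assms(1,2) by (metis finite_distinct_list)
  define zs where "zs = xs @ ys"
  have len: "length xs = card Ne" "length zs = N"
    using xs ys assms(4) by (auto simp: zs_def distinct_card[symmetric])
  have bij: "bij_betw ((!) zs) {..<N} (Ne \<union> Nf)"
    using xs ys assms(3) len by (intro bij_betw_nth) (auto simp: zs_def)
  have zs_Ne: "zs ! i \<in> Ne \<longleftrightarrow> i < card Ne" if "i < N" for i
  proof (cases "i < card Ne")
    case True
    then show ?thesis
      using xs(2) len nth_mem[of i xs] by (simp add: zs_def nth_append)
  next
    case False
    then have "zs ! i \<in> Nf"
      using ys(2) len that nth_mem[of "i - card Ne" ys] by (simp add: zs_def nth_append)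
    then show ?thesis
      using assms(3) False by blast
  qed
  define R where "R j = {i. i < N \<and> i mod p = j}" for j
  define S where "S j = (!) zs ` R j" for j
  have R_sub: "R j \<subseteq> {..<N}" for j
    by (auto simp: R_def)
  have inj: "inj_on ((!) zs) {..<N}"
    using bij by (rule bij_betw_imp_inj_on)
  have card_S: "card (S j) = card (R j)" for j
    unfolding S_def by (intro card_image inj_on_subset[OF inj R_sub])
  have S_disj: "S j \<inter> S k = {}" if "j \<noteq> k" for j k
  proof -
    have "R j \<inter> R k = {}"
      using that by (auto simp: R_def)
    then show ?thesis
      unfolding S_def using inj_on_image_Int[OF inj R_sub R_sub, of j k] by simp
  qed
  have S_ge: "2 \<le> card (S j)" if "j < p" for j
    using card_residue_class_ge[OF assms(6) that] by (simp add: card_S R_def)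
  have S_ne: "S j \<noteq> {}" if "j < p" for j
    using S_ge[OF that] by auto
  \<comment> \<open>Distinct indices give disjoint nonempty sets; injectivity ensures that there are
    exactly \<open>p\<close> platoons.\<close>
  have inj_S: "inj_on S {..<p}"
    using S_disj S_ne by (intro inj_onI) (metis Int_absorb lessThan_iff)
  have Un: "(\<Union>j<p. R j) = {..<N}"
    using assms(5) by (auto simp: R_def)
  have "partition_on (Ne \<union> Nf) (S ` {..<p})"
  proof (rule partition_onI)
    show "\<Union> (S ` {..<p}) = Ne \<union> Nf"
      using bij_betw_imp_surj_on[OF bij] by (simp add: S_def flip: Un image_UN)
    show "disjnt P Q" if "P \<in> S ` {..<p}" "Q \<in> S ` {..<p}" "P \<noteq> Q" for P Q
      using that S_disj unfolding disjnt_def by (metis imageE)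
    show "{} \<notin> S ` {..<p}"
      using S_ne by auto
  qed
  then have "feasible Ne Nf M (S ` {..<p})"
    using S_ge card_residue_class_le[OF assms(7)] by (auto simp: feasible_def card_S R_def)
  moreover have "card (S ` {..<p}) = p"
    using card_image[OF inj_S] by simp
  moreover have "ET_leaders Ne (S ` {..<p}) = min (card Ne) p"
  proof -
    \<comment> \<open>The least position in class \<open>j\<close> is \<open>j\<close> itself, and
      the ETs fill the positions below \<open>card Ne\<close>; so the class contains an ET exactly
      when \<open>j\<close> is one of these positions.\<close>
    have "S j \<inter> Ne \<noteq> {} \<longleftrightarrow> j < card Ne" if "j < p" for j
    proof
      assume "S j \<inter> Ne \<noteq> {}"
      then obtain i where "i \<in> R j" "i < card Ne"
        using zs_Ne by (auto simp: S_def R_def)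
      then show "j < card Ne"
        by (auto simp: R_def intro: le_less_trans[OF mod_less_eq_dividend])
    next
      assume "j < card Ne"
      moreover have "j \<in> R j"
        using that assms(6) by (simp add: R_def)
      ultimately show "S j \<inter> Ne \<noteq> {}"
        using zs_Ne[of j] R_sub[of j] by (auto simp: S_def)
    qed
    then have "{j. j < p \<and> S j \<inter> Ne \<noteq> {}} = {..<min (card Ne) p}"
      by (intro set_eqI) (simp, metis)
    moreover have "{P \<in> S ` {..<p}. P \<inter> Ne \<noteq> {}} = S ` {j. j < p \<and> S j \<inter> Ne \<noteq> {}}"
      by blast
    moreover have "inj_on S {..<min (card Ne) p}"
      by (rule inj_on_subset[OF inj_S]) auto
    ultimately show ?thesis
      by (simp add: ET_leaders_def card_image)
  qed
  ultimately show thesis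
    using that by blast
qed

theorem theorem1:
  fixes Ne Nf :: "'a set" and N M Pstar Le Lf :: nat and \<epsilon>e \<epsilon>f :: real
  assumes "finite Ne" and "finite Nf" and "Ne \<inter> Nf = {}"
    and "N = card Ne + card Nf"
    and "2 \<le> M" and "M < N"
    and "0 < \<epsilon>e" and "\<epsilon>e \<le> \<epsilon>f"
    and "\<exists>P::nat. 1 \<le> P \<and> \<lceil>real N / real M\<rceil> \<le> int P \<and> int P \<le> \<lfloor>real N / 2\<rfloor>"
    and "Pstar = min_platoons Ne Nf M"
    and "Le = min (card Ne) Pstar" and "Lf = Pstar - Le"
  shows "((\<forall>\<P>. optimal Ne Nf M \<epsilon>e \<epsilon>f \<P> \<longrightarrow> card \<P> = Pstar) \<and>
          (M \<ge> 3 \<longrightarrow> int Pstar = \<lceil>real N / real M\<rceil>) \<and>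
          (M = 2 \<and> even N \<longrightarrow> real Pstar = real N / 2)) \<and>
         ((\<exists>\<P>. feasible Ne Nf M \<P> \<and> card \<P> = Pstar \<and>
               ET_leaders Ne \<P> = Le \<and> FPT_leaders Ne \<P> = Lf) \<and>
          (\<forall>\<P>. feasible Ne Nf M \<P> \<and> card \<P> = Pstar \<and>
               ET_leaders Ne \<P> = Le \<and> FPT_leaders Ne \<P> = Lf
               \<longrightarrow> optimal Ne Nf M \<epsilon>e \<epsilon>f \<P>))"
proof -
  note fins = assms(1,2)
  define p where "p = nat \<lceil>real N / real M\<rceil>"
  have M: "0 < real M"
    using assms(5) by simp
  have p_int: "int p = \<lceil>real N / real M\<rceil>"
    using ceiling_mono[of 0 "real N / real M"] by (simp add: p_def)
  \<comment> \<open>This equivalence serves twice: \<open>q = p\<close> gives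
    \<open>N \<le> M * p\<close>, and \<open>q = card \<P>\<close> bounds every feasible structure
    from below.\<close>
  have p_le: "p \<le> q \<longleftrightarrow> N \<le> M * q" for q
  proof -
    have "p \<le> q \<longleftrightarrow> real N / real M \<le> real q"
      unfolding p_def by (simp add: nat_le_iff ceiling_le_iff)
    also have "\<dots> \<longleftrightarrow> real N \<le> real (M * q)"
      using M by (simp add: field_simps)
    finally show ?thesis
      by (simp only: of_nat_le_iff)
  qed
  have N_le: "N \<le> M * p"
    using p_le by blast
  have p_pos: "1 \<le> p"
    using N_le assms(5,6) by (cases p) auto
  \<comment> \<open>The assumed integer lies between \<open>p\<close> and \<open>N / 2\<close>,
    hence \<open>2 * p \<le> N\<close>, and the construction applies with \<open>p\<close>
    platoons.\<close>
  obtain P :: nat where P: "p \<le> P" "int P \<le> \<lfloor>real N / 2\<rfloor>"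
    using assms(9) by (metis p_int of_nat_le_iff)
  have "real P \<le> real N / 2"
    using P(2) by (simp add: le_floor_iff)
  then have two_p: "2 * p \<le> N"
    using P(1) by linarith
  obtain \<Q> where \<Q>: "feasible Ne Nf M \<Q>" "card \<Q> = p" "ET_leaders Ne \<Q> = min (card Ne) p"
    using ex_balanced_partition[OF assms(1-4) p_pos two_p N_le] .
  have ge_p: "p \<le> card \<P>" if "feasible Ne Nf M \<P>" for \<P>
    using card_le_mult_feasible[OF that fins] p_le assms(3,4) fins by (simp add: card_Un_disjoint)
  have Pstar: "Pstar = p"
    unfolding assms(10) min_platoons_def using \<Q>(1,2) ge_p by (intro Least_equality) auto
  let ?V = "total_benefit Ne \<epsilon>e \<epsilon>f" and ?c = "leader_cost \<epsilon>e \<epsilon>f (card Ne)"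
  let ?T = "\<epsilon>e * real (card Ne) + \<epsilon>f * real (card Nf)"
  note mono = leader_cost_strict_mono[OF assms(7,8), of "card Ne"]
  have upper: "?V \<P> \<le> ?T - ?c (card \<P>)" if "feasible Ne Nf M \<P>" for \<P>
    using total_benefit_le[OF that fins assms(3,8)] .
  \<comment> \<open>With \<open>Le\<close> and \<open>Lf\<close> leaders the cost is
    \<open>?c p\<close> by definition, so the upper bound for \<open>p\<close> platoons is met. This
    applies to \<open>\<Q>\<close> and to every structure in part (b).\<close>
  have attained: "?V \<P> = ?T - ?c p"
    if "feasible Ne Nf M \<P>" "ET_leaders Ne \<P> = Le" "FPT_leaders Ne \<P> = Lf" for \<P>
    using total_benefit_eq[OF that(1) fins assms(3,8)] that(2,3)
    by (simp add: leader_cost_def assms(11,12) Pstar)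
  have \<Q>_lead: "ET_leaders Ne \<Q> = Le" "FPT_leaders Ne \<Q> = Lf"
    using \<Q> leaders_add[OF feasible_parts(1)[OF \<Q>(1) fins], of Ne]
    by (auto simp: assms(11,12) Pstar)
  have a: "card \<P> = Pstar" if "optimal Ne Nf M \<epsilon>e \<epsilon>f \<P>" for \<P>
  proof -
    have feas: "feasible Ne Nf M \<P>" and "?V \<Q> \<le> ?V \<P>"
      using that \<Q>(1) by (auto simp: optimal_def)
    \<comment> \<open>An optimal structure cannot pay more for leaders than \<open>\<Q>\<close>
      does; strict monotonicity then gives \<open>card \<P> \<le> p\<close>.\<close>
    then have "?c (card \<P>) \<le> ?c p"
      using upper[OF feas] attained[OF \<Q>(1) \<Q>_lead] by linarith
    then show ?thesis
      using ge_p[OF feas] strict_mono_less_eq[OF mono] Pstar by simp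
  qed
  have b: "optimal Ne Nf M \<epsilon>e \<epsilon>f \<P>"
    if "feasible Ne Nf M \<P>" "ET_leaders Ne \<P> = Le" "FPT_leaders Ne \<P> = Lf" for \<P>
    unfolding optimal_def
  proof (intro conjI allI impI)
    fix \<P>' assume feas: "feasible Ne Nf M \<P>'"
    have "?c p \<le> ?c (card \<P>')"
      using ge_p[OF feas] strict_mono_less_eq[OF mono] by simp
    then show "?V \<P>' \<le> ?V \<P>"
      using upper[OF feas] attained[OF that] by linarith
  qed (rule that(1))
  \<comment> \<open>For \<open>M = 2\<close> the bounds \<open>N \<le> M * p\<close> and
    \<open>2 * p \<le> N\<close> meet.\<close>
  have M2: "real Pstar = real N / 2" if "M = 2"
    using N_le two_p that Pstar by simp
  show ?thesis
    using a b M2 \<Q> \<Q>_lead Pstar p_int by blast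
qed

end
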